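(* Let $\mathbf{Z}\in\mathbb{R}^6$ be fixed and let $\bar f(\mathbf{X})=\mathbf{dexp}_{\mathbf{X}}^T\mathbf{Z}$ for $\mathbf{X}=(\mathbf{x},\mathbf{y})\in\mathbb{R}^3\times\mathbb{R}^3$. With $\mathbf{P}_i=\mathbf{ad}_{\mathbf{X}}^i$ and $\overline{\mathbf{Z}}_i:=\mathbf{P}_i^T\mathbf{Z}$, the Jacobian of $\bar f$ is $$\frac{\partial\bar f}{\partial\mathbf{X}}=a_1\overline{\mathbf{ad}}_{\mathbf{Z}}+a_2\left(\overline{\mathbf{ad}}_{\overline{\mathbf{Z}}_1}+\mathbf{P}_1^T\overline{\mathbf{ad}}_{\mathbf{Z}}\right)+a_3\left(\mathbf{P}_2^T\overline{\mathbf{ad}}_{\mathbf{Z}}+\mathbf{P}_1^T\overline{\mathbf{ad}}_{\overline{\mathbf{Z}}_1}+\overline{\mathbf{ad}}_{\overline{\mathbf{Z}}_2}\right)+a_4\left(\mathbf{P}_3^T\overline{\mathbf{ad}}_{\mathbf{Z}}+\mathbf{P}_1^T\overline{\mathbf{ad}}_{\overline{\mathbf{Z}}_2}+\mathbf{P}_2^T\overline{\mathbf{ad}}_{\overline{\mathbf{Z}}_1}+\overline{\mathbf{ad}}_{\overline{\mathbf{Z}}_3}\right)+\sum_{i=1}^4\bar a_i\,\overline{\mathbf{Z}}_i\begin{bmatrix}\mathbf{x}^T&\mathbf{0}\end{bmatrix}.$$ The limit for $\mathbf{X}\to\mathbf{0}$ is $\frac{\partial\bar f}{\partial\mathbf{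X}}(\mathbf{0})=\frac12\overline{\mathbf{ad}}_{\mathbf{Z}}$.
   Context: For $\mathbf{x}\in\mathbb{R}^3$, $\tilde{\mathbf{x}}$ is the skew-symmetric matrix with $\tilde{\mathbf{x}}\mathbf{w}=\mathbf{x}\times\mathbf{w}$. For $\mathbf{X}=(\mathbf{x},\mathbf{y})\in\mathbb{R}^3\times\mathbb{R}^3\cong se(3)$, $\mathbf{ad}_{\mathbf{X}}=\begin{bmatrix}\tilde{\mathbf{x}}&\mathbf{0}\\ \tilde{\mathbf{y}}&\tilde{\mathbf{x}}\end{bmatrix}$, and for $\mathbf{U}=(\mathbf{u},\mathbf{v})$, $\overline{\mathbf{ad}}_{\mathbf{U}}:=\begin{bmatrix}\tilde{\mathbf{u}}&\tilde{\mathbf{v}}\\ \tilde{\mathbf{v}}&\mathbf{0}\end{bmatrix}$, so that $\mathbf{ad}_{\mathbf{X}}^T\mathbf{U}=\overline{\mathbf{ad}}_{\mathbf{U}}\mathbf{X}$. The matrix of the right-trivialized differential of $\exp$ on $SE(3)$ is $\mathbf{dexp}_{\mathbf{X}}=\sum_{i\ge0}\frac1{(i+1)!}\mathbf{ad}_{\mathbf{X}}^i=\mathbf{I}+\sum_{i=1}^4a_i\,\mathbf{ad}_{\mathbf{X}}^i$. Put $\varphi:=\|\mathbf{x}\|$, $\mathrm{sinc}\,t=\sin t/t$, $\alpha:=\mathrm{sinc}\,\varphi$, $\beta:=\mathrm{sinc}^2\frac\varphi2$, $\delta:=\frac{1-\alpha}{\varphi^2}$. Then $a_1=\beta-\frac\alpha2$,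 $a_2=\frac12(5\delta-\frac\beta2)$, $a_3=\frac1{2\varphi^2}(\beta-\alpha)$, $a_4=\frac1{2\varphi^2}(3\delta-\frac\beta2)$; $\bar a_1=\frac14\beta+\frac1{\varphi^2}(\frac52\alpha-2\beta-\frac12)$, $\bar a_2=\frac1{\varphi^2}(\frac74\beta-\frac12\alpha)+\frac{15}{2\varphi^4}(\alpha-1)$, $\bar a_3=\bar a_1/\varphi^2$, $\bar a_4=\bar a_2/\varphi^2$. These are analytic functions; at $\varphi=0$ they are understood through their (finite) limits. The Jacobian is the $6\times6$ matrix with $\frac{\partial\bar f}{\partial\mathbf{X}}\mathbf{U}=\frac{d}{dt}\bar f(\mathbf{X}+t\mathbf{U})|_{t=0}$. $\begin{bmatrix}\mathbf{x}^T&\mathbf{0}\end{bmatrix}$ is the $1\times6$ row vector with last three entries zero. *)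

theory Defs
  imports "HOL-Analysis.Analysis" "HOL-Probability.Sinc_Integral"
begin

unbundle cross3_syntax

section \<open>Block vectors and matrices\<close>

text \<open>
  \<open>\<real>\<^sup>6\<close> is represented with the six-element index type \<open>3 + 3\<close>, so that the two blocks
  of a vector are the components with index \<open>Inl i\<close> and \<open>Inr i\<close>.
\<close>

type_synonym vec6 = "real^(3+3)"
type_synonym mat6 = "real^(3+3)^(3+3)"

definition vec_join :: "real^3 \<Rightarrow> real^3 \<Rightarrow> vec6" where
  "vec_join x y = (\<chi> k. case k of Inl i \<Rightarrow> x $ i | Inr i \<Rightarrow> y $ i)"

definition part1 :: "vec6 \<Rightarrow> real^3" where
  "part1 X = (\<chi> i. X $ Inl i)"

definition part2 :: "vec6 \<Rightarrow> real^3" where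
  "part2 X = (\<chi> i. X $ Inr i)"

definition block :: "real^3^3 \<Rightarrow> real^3^3 \<Rightarrow> real^3^3 \<Rightarrow> real^3^3 \<Rightarrow> mat6" where
  "block A B C D = (\<chi> k l. case k of
      Inl i \<Rightarrow> (case l of Inl j \<Rightarrow> A $ i $ j | Inr j \<Rightarrow> B $ i $ j)
    | Inr i \<Rightarrow> (case l of Inl j \<Rightarrow> C $ i $ j | Inr j \<Rightarrow> D $ i $ j))"

text \<open>The library's \<open>*\<close> and \<open>^\<close> on type \<^typ>\<open>mat6\<close> act componentwise, hence a separate power.\<close>

primrec matpow :: "mat6 \<Rightarrow> nat \<Rightarrow> mat6" where
  "matpow A 0 = mat 1"
| "matpow A (Suc n) = A ** matpow A n"


section \<open>The adjoint operators and the differential of the exponential map\<close>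

definition skew :: "real^3 \<Rightarrow> real^3^3" where
  "skew x = matrix (\<lambda>w. x \<times> w)"

definition ad :: "vec6 \<Rightarrow> mat6" where
  "ad X = block (skew (part1 X)) 0 (skew (part2 X)) (skew (part1 X))"

definition ad_bar :: "vec6 \<Rightarrow> mat6" where
  "ad_bar U = block (skew (part1 U)) (skew (part2 U)) (skew (part2 U)) 0"

definition dexp :: "vec6 \<Rightarrow> mat6" where
  "dexp X = (\<Sum>i. (1 / fact (i + 1)) *\<^sub>R matpow (ad X) i)"

lemma skew_works: "skew x *v w = x \<times> w"
  by (simp add: skew_def matrix_works linear_iff cross_add_right cross_mult_right)

lemma part_vec_join [simp]: "part1 (vec_join x y) = x" "part2 (vec_join x y) = y"
  by (simp_all add: part1_def part2_def vec_join_def vec_eq_iff)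

lemma vec_join_parts [simp]: "vec_join (part1 X) (part2 X) = X"
  by (simp add: part1_def part2_def vec_join_def vec_eq_iff split: sum.split)

lemma transpose_ad_mult: "transpose (ad X) *v U = ad_bar U *v X"
  by (simp add: vec_eq_iff ad_def ad_bar_def block_def part1_def part2_def skew_def matrix_def
      matrix_vector_mult_def transpose_def sum_3 UNIV_Plus_UNIV[symmetric] sum.Plus split_sum_all
      del: UNIV_Plus_UNIV)
    (simp add: cross3_simps forall_3 axis_def)


section \<open>The coefficient functions\<close>

text \<open>
  \<open>at_zero_lim f\<close> agrees with \<open>f\<close> away from 0, and its value at 0 is the limit of \<open>f\<close> there.
\<close>

definition at_zero_lim :: "(real \<Rightarrow> real) \<Rightarrow> real \<Rightarrow> real" where
  "at_zero_lim f t = (if t = 0 then Lim (at 0) f else f t)"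

definition \<alpha> :: "real \<Rightarrow> real" where
  "\<alpha> t = sinc t"

definition \<beta> :: "real \<Rightarrow> real" where
  "\<beta> t = (sinc (t / 2))\<^sup>2"

definition \<delta> :: "real \<Rightarrow> real" where
  "\<delta> = at_zero_lim (\<lambda>t. (1 - \<alpha> t) / t\<^sup>2)"

definition a1 :: "real \<Rightarrow> real" where
  "a1 t = \<beta> t - \<alpha> t / 2"

definition a2 :: "real \<Rightarrow> real" where
  "a2 t = 1 / 2 * (5 * \<delta> t - \<beta> t / 2)"

definition a3 :: "real \<Rightarrow> real" where
  "a3 = at_zero_lim (\<lambda>t. 1 / (2 * t\<^sup>2) * (\<beta> t - \<alpha> t))"

definition a4 :: "real \<Rightarrow> real" where
  "a4 = at_zero_lim (\<lambda>t. 1 / (2 * t\<^sup>2) * (3 * \<delta> t - \<beta> t / 2))"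

definition a1_bar :: "real \<Rightarrow> real" where
  "a1_bar = at_zero_lim (\<lambda>t. 1 / 4 * \<beta> t + 1 / t\<^sup>2 * (5 / 2 * \<alpha> t - 2 * \<beta> t - 1 / 2))"

definition a2_bar :: "real \<Rightarrow> real" where
  "a2_bar = at_zero_lim
     (\<lambda>t. 1 / t\<^sup>2 * (7 / 4 * \<beta> t - 1 / 2 * \<alpha> t) + 15 / (2 * t ^ 4) * (\<alpha> t - 1))"

definition a3_bar :: "real \<Rightarrow> real" where
  "a3_bar = at_zero_lim (\<lambda>t. a1_bar t / t\<^sup>2)"

definition a4_bar :: "real \<Rightarrow> real" where
  "a4_bar = at_zero_lim (\<lambda>t. a2_bar t / t\<^sup>2)"

definition a_bar :: "nat \<Rightarrow> real \<Rightarrow> real" where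
  "a_bar i = (if i = 1 then a1_bar else if i = 2 then a2_bar else if i = 3 then a3_bar else a4_bar)"


section \<open>The Jacobian\<close>

text \<open>
  The library's \<^const>\<open>jacobian\<close> is the matrix of the Frechet derivative; at points of
  differentiability it is the matrix of directional derivatives.
\<close>

lemma jacobian_directional:
  fixes f :: "vec6 \<Rightarrow> vec6"
  assumes "f differentiable (at X)"
  shows "((\<lambda>t. f (X + t *\<^sub>R U)) has_vector_derivative jacobian f (at X) *v U) (at 0)"
proof -
  have "(f has_derivative (\<lambda>h. jacobian f (at X) *v h)) (at (X + 0 *\<^sub>R U))"
    using assms jacobian_works[of f "at X"] by simp
  moreover have "((\<lambda>t. X + t *\<^sub>R U) has_derivative (\<lambda>t. t *\<^sub>R U)) (at 0)"
    by (auto intro!: derivative_eq_intros)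
  ultimately have "((\<lambda>t. f (X + t *\<^sub>R U)) has_derivative
      (\<lambda>t. jacobian f (at X) *v (t *\<^sub>R U))) (at 0)"
    using has_derivative_compose[of "\<lambda>t. X + t *\<^sub>R U" _ 0 UNIV f] by simp
  then show ?thesis
    by (simp add: has_vector_derivative_def matrix_vector_mult_scaleR)
qed

end

theory Submission
  imports Defs
begin

text \<open>
  Let \<open>A = ad X\<close> and \<open>w = \<parallel>x\<parallel>\<^sup>2\<close>. Since \<open>A\<close> satisfies \<open>A (A\<^sup>2 + w)\<^sup>2 = 0\<close>
  (\<open>ad_quintic\<close>), a function of \<open>A\<^sup>2\<close> multiplied by \<open>A\<close> depends only on its tangent line at
  \<open>- w\<close>. In the series of \<open>dexp\<close>, the odd powers of \<open>A\<close> form \<open>A c\<^sub>2(- A\<^sup>2)\<close> and the even powers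
  after the zeroth form \<open>A\<^sup>2 c\<^sub>3(- A\<^sup>2)\<close>, where \<open>c\<^sub>n(w) = \<Sum>k. (- w)\<^sup>k / (2k + n)!\<close> is the
  Stumpff function. Replacing \<open>c\<^sub>2\<close> and \<open>c\<^sub>3\<close> by their tangent lines gives \<open>dexp X\<close> as a
  polynomial of degree four in \<open>A\<close> (\<open>dexp_eq\<close>). Its coefficients are the intercepts \<open>a1\<close>, \<open>a2\<close> and
  the slopes \<open>a3\<close>, \<open>a4\<close> of these two lines.

  The Stumpff functions are entire, so this form has no singularity at \<open>x = 0\<close>, and
  \<open>w = x \<bullet> x\<close> is smooth in \<open>X\<close> although \<open>\<parallel>x\<parallel>\<close> is not. The trigonometric expressions
  for the coefficients, including the limits at 0, all follow from the recurrence
  \<open>c\<^sub>n(w) = 1/n! - w c\<^sub>n\<^sub>+\<^sub>2(w)\<close> together with \<open>c\<^sub>0(t\<^sup>2) = cos t\<close> and \<open>t c\<^sub>1(t\<^sup>2) = sin t\<close>.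

  It remains to differentiate \<open>Z + \<Sum>i. a\<^sub>i(w) Z\<^sub>i\<close> by the product rule. The vectors
  \<open>Z\<^sub>i\<^sub>+\<^sub>1 = A\<^sup>T Z\<^sub>i\<close> contribute the terms with \<open>ad_bar\<close>
  (\<open>has_derivative_transpose_matpow_mult\<close>), because \<open>A\<^sup>T U = ad_bar U X\<close> is bilinear in \<open>X\<close> and
  \<open>U\<close>. As \<open>dw = 2 x \<bullet> dx\<close>, the coefficients contribute the rank-one terms, with factors
  \<open>2 da\<^sub>i/dw\<close>; these are the barred coefficients. The resulting matrix is continuous in \<open>X\<close>, and at
  \<open>X = 0\<close> only \<open>a1(0) ad_bar Z = ad_bar Z / 2\<close> survives.
\<close>

section \<open>Stumpff functions\<close>

definition stumpff :: "nat \<Rightarrow> real \<Rightarrow> real" where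
  "stumpff n w = (\<Sum>k. (- w) ^ k / fact (2 * k + n))"

lemma summable_stumpff: "summable (\<lambda>k. (- w) ^ k / fact (2 * k + n) :: real)"
proof (rule summable_comparison_test')
  show "summable (\<lambda>k. inverse (fact k) * \<bar>w\<bar> ^ k)"
    by (rule summable_exp)
  show "norm ((- w) ^ k / fact (2 * k + n)) \<le> inverse (fact k) * \<bar>w\<bar> ^ k" for k
  proof -
    have "(fact k :: real) \<le> fact (2 * k + n)"
      by (intro fact_mono) simp
    then have "\<bar>w\<bar> ^ k / fact (2 * k + n) \<le> \<bar>w\<bar> ^ k / fact k"
      by (intro divide_left_mono) simp_all
    then show ?thesis
      by (simp add: power_abs divide_inverse mult.commute abs_mult)
  qed
qed

lemma stumpff_sums: "(\<lambda>k. (- w) ^ k / fact (2 * k + n)) sums stumpff n w"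
  unfolding stumpff_def by (rule summable_sums[OF summable_stumpff])

lemma stumpff_rec: "stumpff n w = 1 / fact n - w * stumpff (n + 2) w"
proof -
  have "(\<lambda>k. (- w) * ((- w) ^ k / fact (2 * k + (n + 2)))) sums ((- w) * stumpff (n + 2) w)"
    by (intro sums_mult stumpff_sums)
  then have "(\<lambda>k. (- w) ^ Suc k / fact (2 * Suc k + n)) sums ((- w) * stumpff (n + 2) w)"
    by simp
  then have "(\<lambda>k. (- w) ^ k / fact (2 * k + n)) sums ((- w) * stumpff (n + 2) w + 1 / fact n)"
    by (subst (asm) sums_Suc_iff) simp
  then show ?thesis
    using sums_unique2[OF stumpff_sums] by fastforce
qed

text \<open>
  The summands are the term-by-term derivatives of the Stumpff series with respect to \<open>- w\<close>.
  They split into summands of two Stumpff series because \<open>2 (k + 1) = (2 k + n + 2) - n\<close>: the first part cancels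
  one factor of the factorial, the second is a constant. Both the derivative of the Stumpff functions
  and the reduction of the powers of \<open>ad X\<close> lead to this sum.
\<close>

lemma stumpff_index_weighted_sums:
  "(\<lambda>k. real k * (- w) ^ (k - 1) / fact (2 * k + n))
     sums ((stumpff (n + 1) w - real n * stumpff (n + 2) w) / 2)"
proof -
  have "(\<lambda>k. ((- w) ^ k / fact (2 * k + (n + 1)) - real n * ((- w) ^ k / fact (2 * k + (n + 2)))) / 2)
      sums ((stumpff (n + 1) w - real n * stumpff (n + 2) w) / 2)"
    by (intro sums_divide sums_diff sums_mult stumpff_sums)
  moreover have "((- w) ^ k / fact (2 * k + (n + 1)) - real n * ((- w) ^ k / fact (2 * k + (n + 2)))) / 2
      = real (Suc k) * (- w) ^ (Suc k - 1) / fact (2 * Suc k + n)" for k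
  proof -
    have "(fact (2 * k + (n + 2)) :: real) = real (2 * k + n + 2) * fact (2 * k + (n + 1))"
      by (simp add: algebra_simps)
    moreover have "(fact (2 * k + (n + 1)) :: real) \<noteq> 0"
      by simp
    moreover have "2 * Suc k + n = 2 * k + (n + 2)"
      by simp
    moreover have "real (2 * k + n + 2) \<noteq> 0"
      by linarith
    moreover have "(a / F - real n * (a / (c * F))) / 2 = real (Suc k) * a / (c * F)"
      if "F \<noteq> 0" "c = real (2 * k + n + 2)" "c \<noteq> 0" for a F c :: real
    proof -
      have "(a / F - real n * (a / (c * F))) / 2 = (c - real n) * a / (2 * (c * F))"
        using that(1,3) by (simp add: field_simps)
      also have "c - real n = 2 * real (Suc k)"
        using that(2) by simp
      finally show ?thesis
        by (simp only: mult.assoc mult_divide_mult_cancel_left_if) simp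
    qed
    ultimately show ?thesis
      by (metis diff_Suc_1)
  qed
  ultimately have "(\<lambda>k. real (Suc k) * (- w) ^ (Suc k - 1) / fact (2 * Suc k + n))
      sums ((stumpff (n + 1) w - real n * stumpff (n + 2) w) / 2)"
    by simp
  then show ?thesis
    by (subst (asm) sums_Suc_iff) simp
qed

lemma DERIV_stumpff:
  "(stumpff n has_real_derivative (real n * stumpff (n + 2) w - stumpff (n + 1) w) / 2) (at w)"
proof -
  let ?c = "\<lambda>k. (- 1) ^ k / fact (2 * k + n) :: real"
  have c: "?c k * x ^ k = (- x) ^ k / fact (2 * k + n)" for k and x :: real
    by (simp add: power_minus[of x])
  have "((\<lambda>x. \<Sum>k. ?c k * x ^ k) has_real_derivative (\<Sum>k. diffs ?c k * w ^ k)) (at w)"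
    by (rule termdiffs_strong_converges_everywhere) (simp only: c summable_stumpff)
  moreover have "(\<lambda>x. \<Sum>k. ?c k * x ^ k) = stumpff n"
    by (simp only: c stumpff_def fun_eq_iff) simp
  moreover have "(\<Sum>k. diffs ?c k * w ^ k) = (real n * stumpff (n + 2) w - stumpff (n + 1) w) / 2"
  proof -
    have "(\<lambda>k. real (Suc k) * (- w) ^ (Suc k - 1) / fact (2 * Suc k + n))
        sums ((stumpff (n + 1) w - real n * stumpff (n + 2) w) / 2)"
      using stumpff_index_weighted_sums[of w n] by (subst sums_Suc_iff) simp
    from sums_minus[OF this] have "(\<lambda>k. diffs ?c k * w ^ k)
        sums (- ((stumpff (n + 1) w - real n * stumpff (n + 2) w) / 2))"
      by (simp add: diffs_def power_minus[of w] mult_ac)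
    then show ?thesis
      by (simp add: sums_iff field_simps)
  qed
  ultimately show ?thesis
    by simp
qed

lemma isCont_stumpff: "isCont (stumpff n) w"
  by (rule DERIV_isCont[OF DERIV_stumpff])

lemma stumpff_0: "stumpff 0 (t\<^sup>2) = cos t"
proof -
  have "(\<lambda>k. (- (t\<^sup>2)) ^ k / fact (2 * k + 0)) sums cos t"
    using cos_paired[of t] by (simp add: power_minus[of "t\<^sup>2"] power_mult)
  then show ?thesis
    using sums_unique2[OF stumpff_sums] by blast
qed

lemma stumpff_1: "t * stumpff 1 (t\<^sup>2) = sin t"
proof -
  have "(\<lambda>k. t * ((- (t\<^sup>2)) ^ k / fact (2 * k + 1))) sums sin t"
    using sin_paired[of t] 
    by (simp add: power_minus[of "t\<^sup>2"] power_mult[symmetric] mult_ac)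
  then show ?thesis
    using sums_unique2[OF sums_mult[OF stumpff_sums]] by blast
qed

text \<open>
  The line \<open>s \<mapsto> intercept m w + slope m w * s\<close> is the tangent at \<open>s = - w\<close> to the graph of
  \<open>s \<mapsto> stumpff m (- s)\<close>; in particular \<open>slope m\<close> is minus the derivative of \<open>stumpff m\<close>.
\<close>

definition slope :: "nat \<Rightarrow> real \<Rightarrow> real" where
  "slope m w = (stumpff (m + 1) w - real m * stumpff (m + 2) w) / 2"

definition intercept :: "nat \<Rightarrow> real \<Rightarrow> real" where
  "intercept m w = stumpff m w + w * slope m w"

definition slope_deriv :: "nat \<Rightarrow> real \<Rightarrow> real" where
  "slope_deriv m w = ((2 * real m + 1) * stumpff (m + 3) w - stumpff (m + 2) w
     - real m * (real m + 2) * stumpff (m + 4) w) / 4"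

lemma DERIV_slope: "(slope m has_real_derivative slope_deriv m w) (at w)"
proof -
  have "(slope m has_real_derivative
      (((real (m + 1) * stumpff (m + 1 + 2) w - stumpff (m + 1 + 1) w) / 2)
       - real m * ((real (m + 2) * stumpff (m + 2 + 2) w - stumpff (m + 2 + 1) w) / 2)) / 2) (at w)"
    unfolding slope_def[abs_def]
    by (intro DERIV_cdivide DERIV_diff DERIV_cmult DERIV_stumpff)
  then show ?thesis
    by (rule DERIV_cong) (simp add: slope_deriv_def eval_nat_numeral field_simps)
qed

text \<open>
  By the product rule the derivative is that of \<open>stumpff m\<close> plus \<open>slope m\<close> plus the term stated, and
  the first two cancel. This is why the first two barred coefficients are \<open>\<phi>\<^sup>2\<close> times the last two.
\<close>

lemma DERIV_intercept: "(intercept m has_real_derivative w * slope_deriv m w) (at w)"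
  unfolding intercept_def[abs_def]
  by (rule derivative_eq_intros DERIV_stumpff DERIV_slope refl)+
    (simp add: slope_def field_simps)

lemma isCont_slope_deriv: "isCont (slope_deriv m) w"
  unfolding slope_deriv_def[abs_def] by (intro continuous_intros isCont_stumpff) simp

section \<open>The coefficient functions\<close>

text \<open>
  The tool that resolves all removable singularities below: a formula valid away from 0 whose right-hand
  side is continuous also describes the limit at 0.
\<close>

lemma at_zero_lim_eq:
  assumes "\<And>t. t \<noteq> 0 \<Longrightarrow> f t = g (t\<^sup>2)" and "isCont g 0"
  shows "at_zero_lim f t = g (t\<^sup>2)"
proof (cases "t = 0")
  case True
  have "((\<lambda>t::real. g (t\<^sup>2)) \<longlongrightarrow> g (0\<^sup>2)) (at 0)"
    by (intro isCont_tendsto_compose[where g = g] tendsto_intros) (use assms(2) in simp)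
  moreover have "\<forall>\<^sub>F t in at 0. g (t\<^sup>2) = f t"
    by (simp add: eventually_at_filter assms(1))
  ultimately have "(f \<longlongrightarrow> g 0) (at 0)"
    using Lim_transform_eventually by fastforce
  then show ?thesis
    using True by (simp add: at_zero_lim_def tendsto_Lim)
qed (simp add: at_zero_lim_def assms(1))

lemma \<alpha>_stumpff: "\<alpha> t = stumpff 1 (t\<^sup>2)"
  using stumpff_1[of t] stumpff_rec[of 1 "0"] by (auto simp: \<alpha>_def field_simps)

lemma \<beta>_stumpff: "\<beta> t = 2 * stumpff 2 (t\<^sup>2)"
proof (cases "t = 0")
  case False
  have "cos t = 1 - 2 * (sin (t / 2))\<^sup>2"
    using cos_double_sin[of "t / 2"] by simp
  moreover have "cos t = 1 - t\<^sup>2 * stumpff 2 (t\<^sup>2)"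
    using stumpff_rec[of 0 "t\<^sup>2"] stumpff_0[of t] by (simp add: numeral_2_eq_2)
  ultimately show ?thesis
    using False by (simp add: \<beta>_def field_simps)
qed (use stumpff_rec[of 2 0] in \<open>simp add: \<beta>_def fact_numeral\<close>)

lemma \<delta>_stumpff: "\<delta> t = stumpff 3 (t\<^sup>2)"
  unfolding \<delta>_def
proof (rule at_zero_lim_eq)
  show "(1 - \<alpha> t) / t\<^sup>2 = stumpff 3 (t\<^sup>2)" if "t \<noteq> 0" for t
    using that stumpff_rec[of 1 "t\<^sup>2"] by (simp add: \<alpha>_stumpff numeral_3_eq_3 field_simps)
qed (rule isCont_stumpff)

text \<open>
  As rewrite rules these express everything through \<open>stumpff 6\<close> and \<open>stumpff 7\<close>, which reduces the
  identities between the coefficient functions to polynomial arithmetic.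
\<close>

lemma stumpff_rec_numeral:
  "stumpff 1 w = 1 - w * stumpff 3 w"
  "stumpff 2 w = 1 / 2 - w * stumpff 4 w"
  "stumpff 3 w = 1 / 6 - w * stumpff 5 w"
  "stumpff 4 w = 1 / 24 - w * stumpff 6 w"
  "stumpff 5 w = 1 / 120 - w * stumpff 7 w"
  by (subst stumpff_rec, simp add: fact_numeral del: One_nat_def)+

lemma slope_numeral:
  "slope 2 w = (stumpff 3 w - 2 * stumpff 4 w) / 2"
  "slope 3 w = (stumpff 4 w - 3 * stumpff 5 w) / 2"
  by (simp_all add: slope_def)

lemma slope_deriv_numeral:
  "slope_deriv 2 w = (5 * stumpff 5 w - stumpff 4 w - 8 * stumpff 6 w) / 4"
  "slope_deriv 3 w = (7 * stumpff 6 w - stumpff 5 w - 15 * stumpff 7 w) / 4"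
  by (simp_all add: slope_deriv_def)

lemma a3_eq: "a3 t = slope 2 (t\<^sup>2)"
  unfolding a3_def
proof (rule at_zero_lim_eq)
  show "1 / (2 * t\<^sup>2) * (\<beta> t - \<alpha> t) = slope 2 (t\<^sup>2)" if "t \<noteq> 0" for t
    unfolding \<alpha>_stumpff \<beta>_stumpff slope_numeral stumpff_rec_numeral[of "t\<^sup>2"]
    using that by (simp add: field_simps)
qed (rule DERIV_isCont[OF DERIV_slope])

lemma a4_eq: "a4 t = slope 3 (t\<^sup>2)"
  unfolding a4_def
proof (rule at_zero_lim_eq)
  show "1 / (2 * t\<^sup>2) * (3 * \<delta> t - \<beta> t / 2) = slope 3 (t\<^sup>2)" if "t \<noteq> 0" for t
    unfolding \<delta>_stumpff \<beta>_stumpff slope_numeral stumpff_rec_numeral[of "t\<^sup>2"]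
    using that by (simp add: field_simps)
qed (rule DERIV_isCont[OF DERIV_slope])

lemma a1_eq: "a1 t = intercept 2 (t\<^sup>2)"
  unfolding a1_def \<alpha>_stumpff \<beta>_stumpff intercept_def slope_numeral stumpff_rec_numeral[of "t\<^sup>2"]
  by (simp add: field_simps)

lemma a2_eq: "a2 t = intercept 3 (t\<^sup>2)"
  unfolding a2_def \<delta>_stumpff \<beta>_stumpff intercept_def slope_numeral stumpff_rec_numeral[of "t\<^sup>2"]
  by (simp add: field_simps)

lemma a1_bar_eq: "a1_bar t = 2 * (t\<^sup>2 * slope_deriv 2 (t\<^sup>2))"
  unfolding a1_bar_def
proof (rule at_zero_lim_eq)
  show "1 / 4 * \<beta> t + 1 / t\<^sup>2 * (5 / 2 * \<alpha> t - 2 * \<beta> t - 1 / 2)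
      = 2 * (t\<^sup>2 * slope_deriv 2 (t\<^sup>2))" if "t \<noteq> 0" for t
    unfolding \<alpha>_stumpff \<beta>_stumpff slope_deriv_numeral stumpff_rec_numeral[of "t\<^sup>2"]
    using that by (simp add: field_simps)
qed (intro continuous_intros isCont_slope_deriv)

lemma a2_bar_eq: "a2_bar t = 2 * (t\<^sup>2 * slope_deriv 3 (t\<^sup>2))"
  unfolding a2_bar_def
proof (rule at_zero_lim_eq)
  show "1 / t\<^sup>2 * (7 / 4 * \<beta> t - 1 / 2 * \<alpha> t) + 15 / (2 * t ^ 4) * (\<alpha> t - 1)
      = 2 * (t\<^sup>2 * slope_deriv 3 (t\<^sup>2))" if "t \<noteq> 0" for t
    unfolding \<alpha>_stumpff \<beta>_stumpff slope_deriv_numeral stumpff_rec_numeral[of "t\<^sup>2"]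
    using that by (simp add: field_simps)
qed (intro continuous_intros isCont_slope_deriv)

lemma a3_bar_eq: "a3_bar t = 2 * slope_deriv 2 (t\<^sup>2)"
  unfolding a3_bar_def
proof (rule at_zero_lim_eq)
  show "a1_bar t / t\<^sup>2 = 2 * slope_deriv 2 (t\<^sup>2)" if "t \<noteq> 0" for t
    using that by (simp add: a1_bar_eq)
qed (intro continuous_intros isCont_slope_deriv)

lemma a4_bar_eq: "a4_bar t = 2 * slope_deriv 3 (t\<^sup>2)"
  unfolding a4_bar_def
proof (rule at_zero_lim_eq)
  show "a2_bar t / t\<^sup>2 = 2 * slope_deriv 3 (t\<^sup>2)" if "t \<noteq> 0" for t
    using that by (simp add: a2_bar_eq)
qed (intro continuous_intros isCont_slope_deriv)

section \<open>The differential of the exponential map as a polynomial in the adjoint\<close>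

lemma transpose_matpow_Suc:
  "transpose (matpow A (Suc n)) = transpose A ** transpose (matpow A n)"
proof -
  have "matpow A n ** A = A ** matpow A n"
    by (induction n) (simp_all add: matrix_mul_assoc[symmetric])
  then show ?thesis
    by (simp flip: matrix_transpose_mul)
qed

lemma ad_mult_vec_join:
  "ad X *v vec_join u v = vec_join (part1 X \<times> u) (part2 X \<times> u + part1 X \<times> v)"
proof -
  have "block A 0 C D *v vec_join u v = vec_join (A *v u) (C *v u + D *v v)" for A C D
    by (simp add: vec_eq_iff block_def vec_join_def matrix_vector_mult_def
        UNIV_Plus_UNIV[symmetric] sum.Plus split_sum_all del: UNIV_Plus_UNIV)
  then show ?thesis
    by (simp add: ad_def skew_works)
qed

text \<open>
  The operator \<open>N = A\<^sup>2 + w\<close> maps \<open>(u, v)\<close> to a vector whose first block is a multiple of \<open>x\<close>,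
  by the Lagrange identity for iterated cross products. On vectors of that kind \<open>A N\<close> vanishes, because
  \<open>A N (u, v) = (0, - 2 (x \<bullet> y) x \<times> u)\<close>.
\<close>

lemma ad_quintic:
  fixes X :: vec6
  defines "w \<equiv> (norm (part1 X))\<^sup>2"
  shows "matpow (ad X) 5 = - (2 * w) *\<^sub>R matpow (ad X) 3 - w\<^sup>2 *\<^sub>R ad X"
proof -
  define x y where "x = part1 X" and "y = part2 X"
  have w: "w = x \<bullet> x"
    by (simp add: w_def x_def power2_norm_eq_inner)
  define N where "N v = ad X *v (ad X *v v) + w *\<^sub>R v" for v
  have add: "vec_join a b + vec_join c d = vec_join (a + c) (b + d)"
    and scale: "r *\<^sub>R vec_join a b = vec_join (r *\<^sub>R a) (r *\<^sub>R b)" for a b c d r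
    by (simp_all add: vec_join_def vec_eq_iff split: sum.split)
  have N: "N (vec_join u v) = vec_join ((x \<bullet> u) *\<^sub>R x)
     ((x \<bullet> v) *\<^sub>R x + (y \<bullet> u) *\<^sub>R x + (x \<bullet> u) *\<^sub>R y - (2 * (x \<bullet> y)) *\<^sub>R u)" for u v
    unfolding N_def ad_mult_vec_join add scale w x_def[symmetric] y_def[symmetric]
    by (rule arg_cong2[where f = vec_join])
      (simp_all add: Lagrange cross_add_right inner_commute algebra_simps vec_eq_iff)
  have ANN: "ad X *v N (N V) = 0" for V
  proof -
    have "ad X *v N (N (vec_join u v)) = 0" for u v
      unfolding N ad_mult_vec_join x_def[symmetric] y_def[symmetric]
      by (simp add: cross_mult_right cross_add_right Cross3.right_diff_distrib inner_add_right 
          inner_diff_right inner_commute cross_skew[of y x] algebra_simps)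
        (simp add: vec_join_def vec_eq_iff split: sum.split)
    from this[of "part1 V" "part2 V"] show ?thesis
      by simp
  qed
  have "(matpow (ad X) 5 + (2 * w) *\<^sub>R matpow (ad X) 3 + w\<^sup>2 *\<^sub>R ad X) *v V = ad X *v N (N V)" for V
    by (simp only: N_def eval_nat_numeral matpow.simps matrix_mul_rid
        matrix_vector_mult_add_rdistrib matrix_vector_mul_assoc[symmetric] power_Suc power_0 mult_1_right
        scaleR_matrix_vector_assoc[symmetric] matrix_vector_mult_scaleR matrix_vector_right_distrib
        mult_2 scaleR_add_left scaleR_add_right scaleR_scaleR add_ac BitM.simps One_nat_def)
  then have "matpow (ad X) 5 + (2 * w) *\<^sub>R matpow (ad X) 3 + w\<^sup>2 *\<^sub>R ad X = 0"
    by (simp add: matrix_eq ANN)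
  then show ?thesis
    by (simp add: algebra_simps eq_neg_iff_add_eq_0)
qed

text \<open>
  This is the expansion of \<open>s\<^sup>k\<close> to first order about \<open>s = - w\<close>, evaluated at \<open>s = A\<^sup>2\<close> and multiplied
  by \<open>A\<close>; the quadratic remainder is annihilated.
\<close>

lemma ad_odd_power:
  fixes X :: vec6 and k :: nat
  defines "w \<equiv> (norm (part1 X))\<^sup>2"
  defines "e \<equiv> real k * (- w) ^ (k - 1)"
  shows "matpow (ad X) (2 * k + 1) = ((- w) ^ k + w * e) *\<^sub>R ad X + e *\<^sub>R matpow (ad X) 3"
  unfolding e_def
proof (induction k)
  case (Suc k)
  \<comment> \<open>The coefficient \<open>e\<close> for the exponent \<open>k\<close> of the induction hypothesis.\<close>
  define r where "r = real k * (- w) ^ (k - 1)"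
  let ?A = "ad X"
  have r: "real (Suc k) * (- w) ^ (Suc k - 1) = (- w) ^ k - w * r"
    by (cases k) (simp_all add: r_def algebra_simps)
  have "matpow ?A (2 * Suc k + 1) = ?A ** (?A ** matpow ?A (2 * k + 1))"
    by simp
  also have "\<dots> = ?A ** (?A ** (((- w) ^ k + w * r) *\<^sub>R ?A + r *\<^sub>R matpow ?A 3))"
    using Suc by (simp add: r_def)
  also have "\<dots> = ((- w) ^ k + w * r) *\<^sub>R matpow ?A 3 + r *\<^sub>R matpow ?A 5"
    by (simp add: matrix_add_ldistrib matrix_scalar_ac scalar_matrix_assoc[symmetric] eval_nat_numeral)
  also have "\<dots> = ((- w) ^ k - w * r) *\<^sub>R matpow ?A 3 + (- w\<^sup>2 * r) *\<^sub>R ?A"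
    unfolding ad_quintic[of X, folded w_def] by (simp add: algebra_simps vec_eq_iff)
  also have "- w\<^sup>2 * r = (- w) ^ Suc k + w * ((- w) ^ k - w * r)"
    by (simp add: algebra_simps power2_eq_square)
  finally show ?case
    unfolding r by (subst add.commute)
qed (simp only: mult_0_right add_0 matpow.simps One_nat_def matrix_mul_rid of_nat_0 mult_zero_left
  mult_zero_right power_0 add_0_right scaleR_one scaleR_zero_left)

lemma sums_even_odd:
  fixes f :: "nat \<Rightarrow> 'a::real_normed_vector"
  assumes "(\<lambda>k. f (2 * k)) sums a" and "(\<lambda>k. f (2 * k + 1)) sums b"
  shows "f sums (a + b)"
proof -
  have mono: "strict_mono (\<lambda>k::nat. 2 * k)" "strict_mono (\<lambda>k::nat. 2 * k + 1)"
    by (simp_all add: strict_mono_def)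
  have "(\<lambda>n. if even n then f n else 0) sums a"
    using assms(1) by (subst sums_mono_reindex[OF mono(1), symmetric]) (metis evenE rangeI, simp)
  moreover have "(\<lambda>n. if odd n then f n else 0) sums b"
    using assms(2) by (subst sums_mono_reindex[OF mono(2), symmetric]) (metis oddE rangeI, simp)
  ultimately have "(\<lambda>n. (if even n then f n else 0) + (if odd n then f n else 0)) sums (a + b)"
    by (rule sums_add)
  also have "(\<lambda>n. (if even n then f n else 0) + (if odd n then f n else 0)) = f"
    by auto
  finally show ?thesis .
qed

text \<open>
  The form in which the reduced powers of \<open>ad X\<close> are summed: \<open>m = 2\<close> for the odd and \<open>m = 3\<close> for the
  even ones.
\<close>

lemma tangent_sums:
  fixes B C :: "'a::real_normed_vector"
  shows "(\<lambda>k. (1 / fact (2 * k + m)) *\<^sub>R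
      (((- w) ^ k + w * (real k * (- w) ^ (k - 1))) *\<^sub>R B + (real k * (- w) ^ (k - 1)) *\<^sub>R C))
     sums (intercept m w *\<^sub>R B + slope m w *\<^sub>R C)"
proof -
  have e: "(\<lambda>k. real k * (- w) ^ (k - 1) / fact (2 * k + m)) sums slope m w"
    unfolding slope_def by (rule stumpff_index_weighted_sums)
  have "(\<lambda>k. ((- w) ^ k / fact (2 * k + m) + w * (real k * (- w) ^ (k - 1) / fact (2 * k + m))) *\<^sub>R B
      + (real k * (- w) ^ (k - 1) / fact (2 * k + m)) *\<^sub>R C)
     sums (intercept m w *\<^sub>R B + slope m w *\<^sub>R C)"
    unfolding intercept_def
    by (intro sums_add sums_mult e stumpff_sums bounded_linear.sums[OF bounded_linear_scaleR_left])
  then show ?thesis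
    by (simp only: scaleR_add_right scaleR_scaleR add_divide_distrib mult_1_left
        times_divide_eq_left times_divide_eq_right)
qed

lemma dexp_eq:
  fixes X :: vec6
  defines "w \<equiv> (norm (part1 X))\<^sup>2"
  shows "dexp X = mat 1 + intercept 2 w *\<^sub>R ad X + intercept 3 w *\<^sub>R matpow (ad X) 2
     + slope 2 w *\<^sub>R matpow (ad X) 3 + slope 3 w *\<^sub>R matpow (ad X) 4"
proof -
  let ?A = "ad X"
  let ?f = "\<lambda>i. (1 / fact (i + 1)) *\<^sub>R matpow ?A i"
  note odd_power = ad_odd_power[of X, folded w_def]
  have "(\<lambda>k. ?f (Suc (2 * k))) sums (intercept 2 w *\<^sub>R ?A + slope 2 w *\<^sub>R matpow ?A 3)"
    using tangent_sums[of 2 w ?A "matpow ?A 3"]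
    unfolding odd_power[symmetric] by simp
  moreover have "(\<lambda>k. ?f (Suc (2 * k + 1))) sums
      (intercept 3 w *\<^sub>R matpow ?A 2 + slope 3 w *\<^sub>R matpow ?A 4)"
  proof -
    have "Suc (2 * k + 1) + 1 = 2 * k + 3" for k :: nat
      by simp
    moreover have "matpow ?A (Suc (2 * k + 1)) = ((- w) ^ k + w * (real k * (- w) ^ (k - 1))) *\<^sub>R matpow ?A 2
        + (real k * (- w) ^ (k - 1)) *\<^sub>R matpow ?A 4" for k
    proof -
      have "matpow ?A (Suc (2 * k + 1)) = ?A ** matpow ?A (2 * k + 1)"
        by simp
      then show ?thesis
        unfolding odd_power
        by (simp add: matrix_add_ldistrib matrix_scalar_ac scalar_matrix_assoc[symmetric] eval_nat_numeral)
    qed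
    ultimately show ?thesis
      using tangent_sums[of 3 w "matpow ?A 2" "matpow ?A 4"]
      by (simp only:)
  qed
  ultimately have "(\<lambda>i. ?f (Suc i)) sums
     ((intercept 2 w *\<^sub>R ?A + slope 2 w *\<^sub>R matpow ?A 3)
      + (intercept 3 w *\<^sub>R matpow ?A 2 + slope 3 w *\<^sub>R matpow ?A 4))"
    by (rule sums_even_odd)
  then have "?f sums
     ((intercept 2 w *\<^sub>R ?A + slope 2 w *\<^sub>R matpow ?A 3)
      + (intercept 3 w *\<^sub>R matpow ?A 2 + slope 3 w *\<^sub>R matpow ?A 4) + ?f 0)"
    by (subst (asm) sums_Suc_iff) simp
  then show ?thesis
    by (simp add: dexp_def sums_iff algebra_simps)
qed

section \<open>The derivative\<close>

lemma bounded_linear_part1: "bounded_linear part1"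
  by (rule linear_conv_bounded_linear[THEN iffD1], rule linearI)
    (simp_all add: part1_def vec_eq_iff)

lemma inner_part1: "u \<bullet> part1 X = vec_join u 0 \<bullet> X"
  by (simp add: inner_vec_def part1_def vec_join_def
      UNIV_Plus_UNIV[symmetric] sum.Plus del: UNIV_Plus_UNIV)

lemma linear_ad_bar: "linear ad_bar"
proof (rule linearI)
  have skew: "skew (u + v) = skew u + skew v" "skew (c *\<^sub>R u) = c *\<^sub>R skew u" for u v c
    by (simp_all add: matrix_eq skew_works matrix_vector_mult_add_rdistrib cross_add_left
        cross_mult_left scaleR_matrix_vector_assoc[symmetric])
  have part: "part1 (U + V) = part1 U + part1 V" "part1 (c *\<^sub>R U) = c *\<^sub>R part1 U"
    "part2 (U + V) = part2 U + part2 V" "part2 (c *\<^sub>R U) = c *\<^sub>R part2 U" for U V c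
    by (simp_all add: part1_def part2_def vec_eq_iff)
  show "ad_bar (U + V) = ad_bar U + ad_bar V" for U V
    by (simp add: ad_bar_def part skew vec_eq_iff block_def split: sum.split)
  show "ad_bar (c *\<^sub>R U) = c *\<^sub>R ad_bar U" for c U
    by (simp add: ad_bar_def part skew vec_eq_iff block_def split: sum.split)
qed

lemma bounded_bilinear_transpose_ad_mult:
  "bounded_bilinear (\<lambda>X V. transpose (ad X) *v V)"
proof -
  have "linear (\<lambda>X. transpose (ad X) *v V)" for V
    unfolding transpose_ad_mult by (rule matrix_vector_mul_linear)
  moreover have "linear (\<lambda>V. transpose (ad X) *v V)" for X
    by (rule matrix_vector_mul_linear)
  ultimately show ?thesis
    unfolding bilinear_conv_bounded_bilinear[symmetric] bilinear_def by blast
qed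

lemma matrix_mul_sum_right:
  fixes A :: "real^'n^'m" and F :: "'i \<Rightarrow> real^'k^'n"
  shows "A ** (\<Sum>i\<in>I. F i) = (\<Sum>i\<in>I. A ** F i)"
proof -
  have zero: "A ** (0 :: real^'k^'n) = 0"
    by (simp add: matrix_matrix_mult_def vec_eq_iff)
  show ?thesis
    by (induction I rule: infinite_finite_induct) (simp_all add: zero matrix_add_ldistrib)
qed

text \<open>
  Each step \<open>Z\<^sub>i\<^sub>+\<^sub>1 = A\<^sup>T Z\<^sub>i\<close> multiplies the Jacobian of \<open>Z\<^sub>i\<close> by \<open>A\<^sup>T\<close> and adds \<open>ad_bar Z\<^sub>i\<close>, which
  comes from differentiating the new factor \<open>A\<^sup>T\<close>.
\<close>

lemma has_derivative_transpose_matpow_mult: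
  "((\<lambda>X. transpose (matpow (ad X) i) *v Z) has_derivative
     (\<lambda>U. (\<Sum>j<i. transpose (matpow (ad X) j) **
              ad_bar (transpose (matpow (ad X) (i - Suc j)) *v Z)) *v U)) (at X)"
proof (induction i)
  case (Suc i)
  let ?Z = "transpose (matpow (ad X) i) *v Z"
  let ?J = "\<Sum>j<i. transpose (matpow (ad X) j) **
              ad_bar (transpose (matpow (ad X) (i - Suc j)) *v Z)"
  from bounded_bilinear.FDERIV[OF bounded_bilinear_transpose_ad_mult has_derivative_ident Suc]
  have "((\<lambda>X. transpose (ad X) *v (transpose (matpow (ad X) i) *v Z)) has_derivative
     (\<lambda>U. transpose (ad X) *v (?J *v U) + transpose (ad U) *v ?Z)) (at X)" .
  then have "((\<lambda>X. transpose (matpow (ad X) (Suc i)) *v Z) has_derivative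
     (\<lambda>U. (transpose (ad X) ** ?J + ad_bar ?Z) *v U)) (at X)"
    by (simp only: transpose_matpow_Suc matrix_vector_mul_assoc[symmetric] transpose_ad_mult[of _ ?Z]
        matrix_vector_mult_add_rdistrib)
  moreover have "transpose (ad X) ** ?J + ad_bar ?Z
      = (\<Sum>j<Suc i. transpose (matpow (ad X) j) **
              ad_bar (transpose (matpow (ad X) (Suc i - Suc j)) *v Z))"
    by (simp only: sum.lessThan_Suc_shift transpose_matpow_Suc matrix_mul_sum_right
        matrix_mul_assoc matpow.simps(1) transpose_mat matrix_mul_lid diff_Suc_Suc diff_zero add.commute)
  ultimately show ?case
    by simp
qed simp

text \<open>
  Working with the squared norm keeps the statement valid where the first block of \<open>X\<close> vanishes.
\<close>

lemma has_derivative_radial: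
  assumes "(g has_real_derivative g') (at ((norm (part1 X))\<^sup>2))"
  shows "((\<lambda>X. g ((norm (part1 X))\<^sup>2)) has_derivative
      (\<lambda>U. 2 * g' * (vec_join (part1 X) 0 \<bullet> U))) (at X)"
proof -
  have swap: "part1 U \<bullet> part1 X = vec_join (part1 X) 0 \<bullet> U" for U
    by (metis inner_commute inner_part1)
  have "((\<lambda>X. part1 X \<bullet> part1 X) has_derivative (\<lambda>U. part1 X \<bullet> part1 U + part1 U \<bullet> part1 X)) (at X)"
    by (intro has_derivative_inner bounded_linear_imp_has_derivative bounded_linear_part1)
  from has_derivative_compose[OF this, of g "(*) g'"] assms
  have "((\<lambda>X. g ((norm (part1 X))\<^sup>2)) has_derivative
      (\<lambda>U. g' * (part1 X \<bullet> part1 U + part1 U \<bullet> part1 X))) (at X)"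
    by (simp add: has_field_derivative_def power2_norm_eq_inner)
  then show ?thesis
    by (rule has_derivative_eq_rhs) (simp add: fun_eq_iff swap inner_part1[of "part1 X"])
qed


lemma columnvector_rowvector_mult:
  fixes a :: "real^'m" and b u :: "real^'n"
  shows "((columnvector a :: real^1^'m) ** rowvector b) *v u = (b \<bullet> u) *\<^sub>R a"
  by (simp add: vec_eq_iff matrix_vector_mult_def matrix_matrix_mult_def columnvector_def
      rowvector_def inner_vec_def sum_distrib_left sum_distrib_right mult_ac)

lemma has_derivative_radial_scaleR:
  fixes v :: "vec6 \<Rightarrow> real^'m"
  assumes "(g has_real_derivative g') (at ((norm (part1 X))\<^sup>2))"
    and "(v has_derivative (\<lambda>U. J *v U)) (at X)"
  shows "((\<lambda>X. g ((norm (part1 X))\<^sup>2) *\<^sub>R v X) has_derivative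
     (\<lambda>U. (g ((norm (part1 X))\<^sup>2) *\<^sub>R J
        + (2 * g') *\<^sub>R ((columnvector (v X) :: real^1^'m) ** rowvector (vec_join (part1 X) 0))) *v U))
     (at X)"
  using has_derivative_scaleR[OF has_derivative_radial[OF assms(1)] assms(2)]
  by (simp only: matrix_vector_mult_add_rdistrib scaleR_matrix_vector_assoc[symmetric]
      columnvector_rowvector_mult scaleR_scaleR)

definition dexp_transpose_jacobian :: "vec6 \<Rightarrow> vec6 \<Rightarrow> mat6" where
  "dexp_transpose_jacobian Z X =
    (let \<phi> = norm (part1 X);
         P = (\<lambda>i. matpow (ad X) i);
         Z_bar = (\<lambda>i. transpose (P i) *v Z)
     in a1 \<phi> *\<^sub>R ad_bar Z
        + a2 \<phi> *\<^sub>R (ad_bar (Z_bar 1) + transpose (P 1) ** ad_bar Z)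
        + a3 \<phi> *\<^sub>R (transpose (P 2) ** ad_bar Z + transpose (P 1) ** ad_bar (Z_bar 1)
                   + ad_bar (Z_bar 2))
        + a4 \<phi> *\<^sub>R (transpose (P 3) ** ad_bar Z + transpose (P 1) ** ad_bar (Z_bar 2)
                   + transpose (P 2) ** ad_bar (Z_bar 1) + ad_bar (Z_bar 3))
        + (\<Sum>i = 1..4. a_bar i \<phi> *\<^sub>R
             ((columnvector (Z_bar i) :: real^1^(3+3)) ** rowvector (vec_join (part1 X) 0))))"

lemma transpose_dexp_mult:
  fixes X :: vec6
  defines "w \<equiv> (norm (part1 X))\<^sup>2"
  shows "transpose (dexp X) *v Z = Z + intercept 2 w *\<^sub>R (transpose (matpow (ad X) 1) *v Z)
    + intercept 3 w *\<^sub>R (transpose (matpow (ad X) 2) *v Z)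
    + slope 2 w *\<^sub>R (transpose (matpow (ad X) 3) *v Z)
    + slope 3 w *\<^sub>R (transpose (matpow (ad X) 4) *v Z)"
proof -
  have "transpose (A + B) = transpose A + transpose B" for A B :: mat6
    by (simp add: transpose_def vec_eq_iff)
  then show ?thesis
    unfolding dexp_eq w_def
    by (simp add: transpose_scalar matrix_vector_mult_add_rdistrib
        scaleR_matrix_vector_assoc[symmetric] del: transpose_matrix_vector)
qed

lemma has_derivative_transpose_dexp_mult:
  "((\<lambda>X. transpose (dexp X) *v Z) has_derivative (\<lambda>U. dexp_transpose_jacobian Z X *v U)) (at X)"
proof -
  let ?P = "\<lambda>i. matpow (ad X) i"
  let ?Z = "\<lambda>i. transpose (?P i) *v Z"
  define J where "J i = (\<Sum>j<i. transpose (?P j) ** ad_bar (?Z (i - Suc j)))" for i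
  define R where "R i = (columnvector (?Z i) :: real^1^(3+3)) ** rowvector (vec_join (part1 X) 0)" for i
  define w where "w = (norm (part1 X))\<^sup>2"
  note summand = has_derivative_radial_scaleR[OF _ has_derivative_transpose_matpow_mult,
      of _ _ X _ Z, folded w_def, folded J_def R_def]
  have "((\<lambda>X. transpose (dexp X) *v Z) has_derivative
     (\<lambda>U. 0 + (intercept 2 w *\<^sub>R J 1 + (2 * (w * slope_deriv 2 w)) *\<^sub>R R 1) *v U
       + (intercept 3 w *\<^sub>R J 2 + (2 * (w * slope_deriv 3 w)) *\<^sub>R R 2) *v U
       + (slope 2 w *\<^sub>R J 3 + (2 * slope_deriv 2 w) *\<^sub>R R 3) *v U
       + (slope 3 w *\<^sub>R J 4 + (2 * slope_deriv 3 w) *\<^sub>R R 4) *v U)) (at X)"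
    unfolding transpose_dexp_mult
    by (intro has_derivative_add has_derivative_const summand DERIV_intercept DERIV_slope)
  moreover have "J 1 = ad_bar Z"
    "J 2 = ad_bar (?Z 1) + transpose (?P 1) ** ad_bar Z"
    "J 3 = transpose (?P 2) ** ad_bar Z + transpose (?P 1) ** ad_bar (?Z 1) + ad_bar (?Z 2)"
    "J 4 = transpose (?P 3) ** ad_bar Z + transpose (?P 1) ** ad_bar (?Z 2)
       + transpose (?P 2) ** ad_bar (?Z 1) + ad_bar (?Z 3)"
    by (simp_all add: J_def eval_nat_numeral add_ac del: transpose_matrix_vector matpow.simps(2))
  moreover have "(\<Sum>i = 1..4. a_bar i \<phi> *\<^sub>R R i)
      = a1_bar \<phi> *\<^sub>R R 1 + a2_bar \<phi> *\<^sub>R R 2 + a3_bar \<phi> *\<^sub>R R 3 + a4_bar \<phi> *\<^sub>R R 4" for \<phi>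
    by (simp add: eval_nat_numeral a_bar_def)
  ultimately show ?thesis
    unfolding dexp_transpose_jacobian_def Let_def R_def[symmetric]
    by (elim has_derivative_eq_rhs)
      (simp add: a1_eq a2_eq a3_eq a4_eq a1_bar_eq a2_bar_eq a3_bar_eq a4_bar_eq w_def fun_eq_iff
        matrix_vector_mult_add_rdistrib)
qed

lemma differentiable_transpose_dexp_mult:
  "(\<lambda>X. transpose (dexp X) *v Z) differentiable (at X)"
  using has_derivative_transpose_dexp_mult by (rule differentiableI)

lemma jacobian_transpose_dexp_mult:
  "jacobian (\<lambda>X. transpose (dexp X) *v Z) (at X) = dexp_transpose_jacobian Z X"
  unfolding jacobian_def frechet_derivative_at[OF has_derivative_transpose_dexp_mult, symmetric]
  by (rule matrix_of_matrix_vector_mul)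

section \<open>Continuity of the Jacobian\<close>

lemma dexp_transpose_jacobian_0: "dexp_transpose_jacobian Z 0 = (1 / 2) *\<^sub>R ad_bar Z"
proof -
  have part: "part1 0 = 0" "part2 0 = 0"
    by (simp_all add: part1_def part2_def vec_eq_iff)
  have "a1 0 = 1 / 2"
    using stumpff_rec[of 2 0] by (simp add: a1_eq intercept_def fact_numeral)
  moreover have "transpose (matpow (ad 0) (Suc i)) = 0" for i
  proof -
    have "skew 0 = 0"
      by (simp add: matrix_eq skew_works)
    then have "ad 0 = 0"
      by (simp add: ad_def block_def part vec_eq_iff split: sum.split)
    then show ?thesis
      by (simp add: transpose_def matrix_matrix_mult_def vec_eq_iff)
  qed
  moreover have "0 ** M = 0" for M :: mat6
    by (simp add: matrix_matrix_mult_def vec_eq_iff)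
  moreover have "(columnvector 0 :: real^1^(3+3)) ** rowvector v = 0" for v :: vec6
    by (simp add: matrix_matrix_mult_def columnvector_def vec_eq_iff)
  ultimately show ?thesis
    by (simp add: dexp_transpose_jacobian_def Let_def part eval_nat_numeral linear_0[OF linear_ad_bar]
        del: transpose_matrix_vector matpow.simps(2))
qed

lemma tendsto_matrix_matrix_mult:
  fixes A :: "'a \<Rightarrow> real^'n^'m" and B :: "'a \<Rightarrow> real^'k^'n"
  assumes "(A \<longlongrightarrow> a) F" and "(B \<longlongrightarrow> b) F"
  shows "((\<lambda>x. A x ** B x) \<longlongrightarrow> a ** b) F"
  unfolding matrix_matrix_mult_def by (intro tendsto_intros assms)

lemma tendsto_matrix_vector_mult:
  fixes A :: "'a \<Rightarrow> real^'n^'m"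
  assumes "(A \<longlongrightarrow> a) F" and "(v \<longlongrightarrow> b) F"
  shows "((\<lambda>x. A x *v v x) \<longlongrightarrow> a *v b) F"
  unfolding matrix_vector_mult_def by (intro tendsto_intros assms)

lemma tendsto_transpose:
  fixes A :: "'a \<Rightarrow> real^'n^'m"
  assumes "(A \<longlongrightarrow> a) F"
  shows "((\<lambda>x. transpose (A x)) \<longlongrightarrow> transpose a) F"
  unfolding transpose_def by (intro tendsto_intros assms)

lemma tendsto_vec_join_0:
  assumes "(x \<longlongrightarrow> a) F"
  shows "((\<lambda>t. vec_join (x t) 0) \<longlongrightarrow> vec_join a 0) F"
proof (rule vec_tendstoI)
  show "((\<lambda>t. vec_join (x t) 0 $ k) \<longlongrightarrow> vec_join a 0 $ k) F" for k
    by (cases k) (simp_all add: vec_join_def tendsto_vec_nth[OF assms])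
qed

lemma tendsto_columnvector_rowvector:
  fixes a :: "'a \<Rightarrow> real^'m" and b :: "'a \<Rightarrow> real^'n"
  assumes "(a \<longlongrightarrow> a') F" and "(b \<longlongrightarrow> b') F"
  shows "((\<lambda>x. (columnvector (a x) :: real^1^'m) ** rowvector (b x))
     \<longlongrightarrow> (columnvector a' :: real^1^'m) ** rowvector b') F"
proof -
  have outer: "(columnvector u :: real^1^'m) ** rowvector v = (\<chi> i j. u $ i * v $ j)"
    for u :: "real^'m" and v :: "real^'n"
    by (simp add: matrix_matrix_mult_def columnvector_def rowvector_def vec_eq_iff)
  show ?thesis
    unfolding outer by (intro tendsto_intros assms)
qed

text \<open>
  The rows of \<open>ad X\<close> are linear in \<open>X\<close>: transposing turns a row into the image of a unit vector, and
  there the roles of matrix and vector can be exchanged.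
\<close>

lemma tendsto_ad: "(ad \<longlongrightarrow> ad X) (at X)"
proof -
  have "transpose (ad X) *v axis k 1 = ad_bar (axis k 1) *v X" for X k
    by (rule transpose_ad_mult)
  then have row: "ad X $ k = ad_bar (axis k 1) *v X" for X k
    by (simp add: matrix_vector_mult_basis column_def transpose_def vec_lambda_eta)
  show ?thesis
    by (rule vec_tendstoI) (unfold row, intro tendsto_matrix_vector_mult tendsto_intros)
qed

lemma tendsto_matpow_ad: "((\<lambda>X. matpow (ad X) n) \<longlongrightarrow> matpow (ad X) n) (at X)"
  by (induction n) (simp_all add: tendsto_matrix_matrix_mult tendsto_ad)

lemma tendsto_ad_bar:
  assumes "(v \<longlongrightarrow> b) F"
  shows "((\<lambda>x. ad_bar (v x)) \<longlongrightarrow> ad_bar b) F"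
  using linear_ad_bar assms by (intro bounded_linear.tendsto[of ad_bar])
    (simp_all add: linear_conv_bounded_linear)

lemma tendsto_coefficients:
  assumes "(r \<longlongrightarrow> \<phi>) F"
  shows "((\<lambda>x. a1 (r x)) \<longlongrightarrow> a1 \<phi>) F" "((\<lambda>x. a2 (r x)) \<longlongrightarrow> a2 \<phi>) F"
    "((\<lambda>x. a3 (r x)) \<longlongrightarrow> a3 \<phi>) F" "((\<lambda>x. a4 (r x)) \<longlongrightarrow> a4 \<phi>) F"
    "((\<lambda>x. a_bar i (r x)) \<longlongrightarrow> a_bar i \<phi>) F"
proof -
  have square: "((\<lambda>x. (r x)\<^sup>2) \<longlongrightarrow> \<phi>\<^sup>2) F"
    by (intro tendsto_intros assms)
  note slope = isCont_tendsto_compose[OF DERIV_isCont[OF DERIV_slope] square]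
    and intercept = isCont_tendsto_compose[OF DERIV_isCont[OF DERIV_intercept] square]
    and slope_deriv = isCont_tendsto_compose[OF isCont_slope_deriv square]
  show "((\<lambda>x. a1 (r x)) \<longlongrightarrow> a1 \<phi>) F" "((\<lambda>x. a2 (r x)) \<longlongrightarrow> a2 \<phi>) F"
    "((\<lambda>x. a3 (r x)) \<longlongrightarrow> a3 \<phi>) F" "((\<lambda>x. a4 (r x)) \<longlongrightarrow> a4 \<phi>) F"
    unfolding a1_eq a2_eq a3_eq a4_eq by (rule intercept slope)+
  show "((\<lambda>x. a_bar i (r x)) \<longlongrightarrow> a_bar i \<phi>) F"
    unfolding a_bar_def
    by (auto simp: a1_bar_eq a2_bar_eq a3_bar_eq a4_bar_eq intro!: tendsto_intros square slope_deriv)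
qed

lemma tendsto_dexp_transpose_jacobian:
  "(dexp_transpose_jacobian Z \<longlongrightarrow> dexp_transpose_jacobian Z X) (at X)"
proof -
  have "(part1 \<longlongrightarrow> part1 X) (at X)"
    using bounded_linear.tendsto[OF bounded_linear_part1 tendsto_ident_at] .
  then show ?thesis
    unfolding dexp_transpose_jacobian_def[abs_def] Let_def
    (* The left factor in tendsto_matrix_matrix_mult is restricted to a transpose so that the rank-one
       products are left to tendsto_columnvector_rowvector. *)
    by (intro tendsto_add tendsto_scaleR tendsto_sum tendsto_coefficients tendsto_norm tendsto_const
        tendsto_matrix_matrix_mult[of "\<lambda>X. transpose (M X)" for M]
        tendsto_columnvector_rowvector tendsto_matrix_vector_mult
        tendsto_transpose tendsto_ad_bar tendsto_matpow_ad tendsto_vec_join_0)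
qed

theorem lemma4:
  fixes Z :: vec6
  shows "let f = (\<lambda>X. transpose (dexp X) *v Z) in
    (\<forall>x y. let X = vec_join x y;
               \<phi> = norm x;
               P = (\<lambda>i. matpow (ad X) i);
               Z_bar = (\<lambda>i. transpose (P i) *v Z)
           in f differentiable (at X) \<and>
              jacobian f (at X) =
                a1 \<phi> *\<^sub>R ad_bar Z
              + a2 \<phi> *\<^sub>R (ad_bar (Z_bar 1) + transpose (P 1) ** ad_bar Z)
              + a3 \<phi> *\<^sub>R (transpose (P 2) ** ad_bar Z + transpose (P 1) ** ad_bar (Z_bar 1)
                         + ad_bar (Z_bar 2))
              + a4 \<phi> *\<^sub>R (transpose (P 3) ** ad_bar Z + transpose (P 1) ** ad_bar (Z_bar 2)
                         + transpose (P 2) ** ad_bar (Z_bar 1) + ad_bar (Z_bar 3))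
              + (\<Sum>i = 1..4. a_bar i \<phi> *\<^sub>R
                   ((columnvector (Z_bar i) :: real^1^(3+3)) ** rowvector (vec_join x 0))))
    \<and> ((\<lambda>X. jacobian f (at X)) \<longlongrightarrow> (1 / 2) *\<^sub>R ad_bar Z) (at 0)
    \<and> jacobian f (at 0) = (1 / 2) *\<^sub>R ad_bar Z"
proof -
  have "((\<lambda>X. jacobian (\<lambda>X. transpose (dexp X) *v Z) (at X)) \<longlongrightarrow> (1 / 2) *\<^sub>R ad_bar Z) (at 0)"
    unfolding jacobian_transpose_dexp_mult
    using tendsto_dexp_transpose_jacobian[of Z 0] by (simp only: dexp_transpose_jacobian_0)
  moreover have "jacobian (\<lambda>X. transpose (dexp X) *v Z) (at 0) = (1 / 2) *\<^sub>R ad_bar Z"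
    by (simp only: jacobian_transpose_dexp_mult dexp_transpose_jacobian_0)
  moreover note differentiable_transpose_dexp_mult[of Z]
    and jacobian_transpose_dexp_mult[of Z "vec_join x y" for x y,
      unfolded dexp_transpose_jacobian_def Let_def part_vec_join]
  ultimately show ?thesis
    unfolding Let_def by blast
qed

end
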